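(* There exist a set $\mathcal{P}=\{P_1,P_2,P_3,P_4\}$ of four directed spanning paths on a common vertex set and two sets of vectors $\{\vec v_1,\vec v_2,\vec v_3,\vec v_4\}$ and $\{\vec v_1',\vec v_2',\vec v_3',\vec v_4'\}$ in $\mathbb{R}^2$ with the same radial order around the origin, such that $\mathcal{P}$ admits a $\{\vec v_1,\vec v_2,\vec v_3,\vec v_4\}$-monotone simultaneous embedding, but does not admit a $\{\vec v_1',\vec v_2',\vec v_3',\vec v_4'\}$-monotone simultaneous embedding.
   Context: A directed spanning path on $V$ is a simple directed path visiting every vertex of $V$ exactly once, directed from one end to the other. For a nonzero vector $\vec v\in\mathbb{R}^2$, a drawing of a digraph (vertices are distinct points, edges are curves) is $\vec v$-monotone if every edge is drawn as a directed curve that is monotonically increasing in direction $\vec v$. Given digraphs $G_1,\dots,G_k$ on the same vertex set $V$ and vectors $\vec v_1,\dots,\vec v_k$, a $\{\vec v_1,\dots,\vec v_k\}$-monotone simultaneous embedding consists of planar drawings $\Gamma_1,\dots,\Gamma_k$ such that $\Gamma_i$ is a $\vec v_i$-monotone drawing of $G_i$ for each $i$ (the vector $\vec v_i$ belongs to the $i$-th graph), and each vertex of $V$ is represented by the same point in all the drawings. Same radial order: directions are considered up to simultaneously reversing a path and its vector (so that all vectors may be assumed to point into a common half-plane). Accordingly, $\vec v_1',\dots,\vec v_4'$ have the same radial order around the origin as $\vec v_1,\dots,\vec v_4$ if the eight rays spanned by $\pm\vec v_1',\dots,\pm\vec v_4'$ appear around the origin in the same counterclockwise cyclic order (with the same coincidences)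 as the eight rays spanned by $\pm\vec v_1,\dots,\pm\vec v_4$, under the correspondence $\pm\vec v_i\leftrightarrow\pm\vec v_i'$. *)

theory Defs
  imports
    "HOL-Analysis.Analysis"
    "Graph_Theory.Pair_Digraph"
    "Graph_Theory.Vertex_Walk"
begin

text \<open>
  A spanning path is itself a digraph: its arcs are exactly the consecutive pairs of
  a repetition-free list of all the vertices, directed along the list.
\<close>

definition directed_spanning_path :: "'a set \<Rightarrow> 'a pair_pre_digraph \<Rightarrow> bool" where
  "directed_spanning_path V G \<longleftrightarrow>
     pverts G = V \<and>
     (\<exists>p. vpath p (with_proj G) \<and> set p = V \<and> parcs G = set (vwalk_arcs p))"

text \<open>
  A drawing is a placement \<open>pos\<close> of the vertices together with a curve \<open>\<gamma> e\<close>
  on \<open>[0, 1]\<close> for every arc \<open>e\<close>, parametrized from the tail to the head of the arc.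
\<close>

definition drawing ::
    "'a pair_pre_digraph \<Rightarrow> ('a \<Rightarrow> real ^ 2) \<Rightarrow> ('a \<times> 'a \<Rightarrow> real \<Rightarrow> real ^ 2) \<Rightarrow> bool" where
  "drawing G pos \<gamma> \<longleftrightarrow>
     inj_on pos (pverts G) \<and>
     (\<forall>e\<in>parcs G. path (\<gamma> e) \<and>
        pathstart (\<gamma> e) = pos (fst e) \<and> pathfinish (\<gamma> e) = pos (snd e))"

text \<open>
  Endpoints are excluded from the curves below, so that two edges may meet, but only
  at the image of a common end vertex.
\<close>

definition planar_drawing ::
    "'a pair_pre_digraph \<Rightarrow> ('a \<Rightarrow> real ^ 2) \<Rightarrow> ('a \<times> 'a \<Rightarrow> real \<Rightarrow> real ^ 2) \<Rightarrow> bool" where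
  "planar_drawing G pos \<gamma> \<longleftrightarrow>
     drawing G pos \<gamma> \<and>
     (\<forall>e\<in>parcs G. simple_path (\<gamma> e) \<and> \<gamma> e ` {0<..<1} \<inter> pos ` pverts G = {}) \<and>
     (\<forall>e\<in>parcs G. \<forall>e'\<in>parcs G. e \<noteq> e' \<longrightarrow> \<gamma> e ` {0<..<1} \<inter> \<gamma> e' ` {0<..<1} = {})"

definition monotone_drawing ::
    "real ^ 2 \<Rightarrow> 'a pair_pre_digraph \<Rightarrow> ('a \<times> 'a \<Rightarrow> real \<Rightarrow> real ^ 2) \<Rightarrow> bool" where
  "monotone_drawing v G \<gamma> \<longleftrightarrow>
     (\<forall>e\<in>parcs G. strict_mono_on {0..1} (\<lambda>t. v \<bullet> \<gamma> e t))"

text \<open>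
  The placement is shared by all the drawings, whereas the curves \<open>\<Gamma> i\<close> belong to the
  \<open>i\<close>-th drawing: curves of different drawings may cross.
\<close>

definition monotone_simultaneous_embedding ::
    "('k \<Rightarrow> 'a pair_pre_digraph) \<Rightarrow> ('k \<Rightarrow> real ^ 2) \<Rightarrow>
     ('a \<Rightarrow> real ^ 2) \<Rightarrow> ('k \<Rightarrow> 'a \<times> 'a \<Rightarrow> real \<Rightarrow> real ^ 2) \<Rightarrow> bool" where
  "monotone_simultaneous_embedding G v pos \<Gamma> \<longleftrightarrow>
     (\<forall>i. planar_drawing (G i) pos (\<Gamma> i) \<and> monotone_drawing (v i) (G i) (\<Gamma> i))"

definition admits_monotone_simultaneous_embedding ::
    "('k \<Rightarrow> 'a pair_pre_digraph) \<Rightarrow> ('k \<Rightarrow> real ^ 2) \<Rightarrow> bool" where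
  "admits_monotone_simultaneous_embedding G v \<longleftrightarrow>
     (\<exists>pos \<Gamma>. monotone_simultaneous_embedding G v pos \<Gamma>)"

text \<open>
  For nonzero \<open>u\<close> and \<open>w\<close>, the angle in \<open>[0, 2\<pi>)\<close> of the counterclockwise rotation
  taking the ray spanned by \<open>u\<close> to the ray spanned by \<open>w\<close>.
\<close>

definition ccw_angle :: "real ^ 2 \<Rightarrow> real ^ 2 \<Rightarrow> real" where
  "ccw_angle u w = Arg2pi (Complex (w $ 1) (w $ 2) / Complex (u $ 1) (u $ 2))"

definition signed_vector :: "('k \<Rightarrow> real ^ 2) \<Rightarrow> 'k \<times> bool \<Rightarrow> real ^ 2" where
  "signed_vector v = (\<lambda>(i, s). if s then v i else - v i)"

text \<open>
  Sweeping counterclockwise from any ray \<open>a\<close>, the other rays are met in the same (weak)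
  order in both families. The instance \<open>c = a\<close> says that \<open>a\<close> and \<open>b\<close> span the same
  ray in one family iff they do in the other.
\<close>

definition same_radial_order :: "('k \<Rightarrow> real ^ 2) \<Rightarrow> ('k \<Rightarrow> real ^ 2) \<Rightarrow> bool" where
  "same_radial_order v v' \<longleftrightarrow>
     (\<forall>a b c.
        ccw_angle (signed_vector v a) (signed_vector v b)
          \<le> ccw_angle (signed_vector v a) (signed_vector v c) \<longleftrightarrow>
        ccw_angle (signed_vector v' a) (signed_vector v' b)
          \<le> ccw_angle (signed_vector v' a) (signed_vector v' c))"

end

theory Submission
  imports Defs
begin

text \<open>A path whose vertices project onto \<open>v\<close> in path order has a
  \<open>v\<close>-monotone planar drawing with straight edges, and every \<open>v\<close>-monotone
  drawing forces that order. So an embedding exists exactly when one placement sorts all four paths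
  along their vectors (\<open>admits_monotone_simultaneous_embedding_path_graph_iff\<close>). Take
  the vectors (1,0), (0,1), (1,1) and (1,t). Their radial order is the same for every t > 1
  (\<open>same_radial_order_slope_vectors\<close>), whereas the sorting conditions are linear
  inequalities with t as a coefficient, so the size of t matters. For the paths
  \<open>witness_path\<close> they have a solution at t = 3/2
  (\<open>witness_path_embedding\<close>) and are contradictory for t \<ge> 2
  (\<open>witness_path_no_embedding\<close>).\<close>

section \<open>Spanning paths as lists sorted by a real function\<close>

definition path_graph :: "'a list \<Rightarrow> 'a pair_pre_digraph" where
  "path_graph p = \<lparr>pverts = set p, parcs = set (vwalk_arcs p)\<rparr>"

lemma directed_spanning_path_path_graph:
  assumes "distinct p" "p \<noteq> []"
  shows "directed_spanning_path (set p) (path_graph p)"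
proof -
  have "vpath p (with_proj (path_graph p))"
    using assms by (auto simp: vpath_def vwalk_def path_graph_def arcs_ends_def arc_to_ends_def)
  then show ?thesis
    by (auto simp: directed_spanning_path_def path_graph_def)
qed

lemma vwalk_arcs_subset: "e \<in> set (vwalk_arcs p) \<Longrightarrow> fst e \<in> set p \<and> snd e \<in> set p"
  by (induction p rule: vwalk_arcs.induct) auto

text \<open>By transitivity of \<open><\<close>, comparing neighbours suffices. This turns
  monotonicity, a condition on arcs, into one on the whole vertex order.\<close>

lemma sorted_wrt_vwalk_arcs_iff:
  fixes f :: "'a \<Rightarrow> real"
  shows "sorted_wrt (\<lambda>a b. f a < f b) p \<longleftrightarrow> (\<forall>e\<in>set (vwalk_arcs p). f (fst e) < f (snd e))"
  by (induction p rule: vwalk_arcs.induct) auto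

text \<open>Arcs join neighbouring entries of a sorted list. This keeps vertices out of the open
  strip swept by a straight edge.\<close>

lemma sorted_wrt_arc_no_vertex_between:
  fixes f :: "'a \<Rightarrow> real"
  assumes "sorted_wrt (\<lambda>a b. f a < f b) p" "e \<in> set (vwalk_arcs p)" "u \<in> set p"
  shows "f u \<le> f (fst e) \<or> f (snd e) \<le> f u"
  using assms
proof (induction p rule: vwalk_arcs.induct)
  case (3 x y p)
  then show ?case using vwalk_arcs_subset[of e "y # p"] by force
qed auto

lemma sorted_wrt_arcs_separated:
  fixes f :: "'a \<Rightarrow> real"
  assumes "sorted_wrt (\<lambda>a b. f a < f b) p"
    and "e \<in> set (vwalk_arcs p)" "e' \<in> set (vwalk_arcs p)" "e \<noteq> e'"
  shows "f (snd e) \<le> f (fst e') \<or> f (snd e') \<le> f (fst e)"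
  using assms
proof (induction p rule: vwalk_arcs.induct)
  case (3 x y p)
  then show ?case
    using vwalk_arcs_subset[of e "y # p"] vwalk_arcs_subset[of e' "y # p"] by force
qed auto

lemma inj_on_if_sorted_wrt:
  fixes f :: "'a \<Rightarrow> real"
  assumes "sorted_wrt (\<lambda>a b. f a < f b) p"
  shows "inj_on f (set p)"
  using assms by (induction p) force+

section \<open>Reduction of embeddings to vertex placements\<close>

lemma inner_linepath:
  "v \<bullet> linepath a b t = v \<bullet> a + t * (v \<bullet> b - v \<bullet> a)"
  by (simp add: linepath_def algebra_simps)

text \<open>
  Edges of a \<open>v\<close>-monotone spanning path occupy disjoint strips orthogonal to \<open>v\<close>, so straight
  segments never cross.
\<close>

lemma admits_monotone_simultaneous_embedding_path_graph_iff:
  "admits_monotone_simultaneous_embedding (\<lambda>i. path_graph (p i)) v \<longleftrightarrow>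
     (\<exists>pos. \<forall>i. sorted_wrt (\<lambda>a b. v i \<bullet> pos a < v i \<bullet> pos b) (p i))"
  (is "?L \<longleftrightarrow> ?R")
proof
  assume ?L
  then obtain pos \<Gamma> where emb: "monotone_simultaneous_embedding (\<lambda>i. path_graph (p i)) v pos \<Gamma>"
    by (auto simp: admits_monotone_simultaneous_embedding_def)
  \<comment> \<open>Of each curve only the two end parameters 0 and 1 are used, so its shape is
    irrelevant.\<close>
  have "v i \<bullet> pos (fst e) < v i \<bullet> pos (snd e)" if e: "e \<in> set (vwalk_arcs (p i))" for i e
  proof -
    have "strict_mono_on {0..1} (\<lambda>t. v i \<bullet> \<Gamma> i e t)"
      and "\<Gamma> i e 0 = pos (fst e)" "\<Gamma> i e 1 = pos (snd e)"
      using emb e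
      by (auto simp: monotone_simultaneous_embedding_def planar_drawing_def drawing_def
          monotone_drawing_def path_graph_def pathstart_def pathfinish_def)
    then show ?thesis
      using strict_mono_onD[of "{0..1::real}" "\<lambda>t. v i \<bullet> \<Gamma> i e t" 0 1] by simp
  qed
  then have "\<forall>i. sorted_wrt (\<lambda>a b. v i \<bullet> pos a < v i \<bullet> pos b) (p i)"
    unfolding sorted_wrt_vwalk_arcs_iff by blast
  then show ?R
    by blast
next
  assume ?R
  then obtain pos where pos: "\<And>i. sorted_wrt (\<lambda>a b. v i \<bullet> pos a < v i \<bullet> pos b) (p i)"
    by blast
  define \<gamma> where "\<gamma> e = linepath (pos (fst e)) (pos (snd e))" for e
  have less: "v i \<bullet> pos (fst e) < v i \<bullet> pos (snd e)" if "e \<in> set (vwalk_arcs (p i))" for i e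
    using pos[of i] that by (simp add: sorted_wrt_vwalk_arcs_iff)
  have strip: "v i \<bullet> pos (fst e) < v i \<bullet> x \<and> v i \<bullet> x < v i \<bullet> pos (snd e)"
    if e: "e \<in> set (vwalk_arcs (p i))" and x: "x \<in> \<gamma> e ` {0<..<1}" for i e x
  proof -
    obtain t where t: "0 < t" "t < 1" "x = \<gamma> e t"
      using x by auto
    let ?d = "v i \<bullet> pos (snd e) - v i \<bullet> pos (fst e)"
    have "0 < t * ?d" "t * ?d < ?d"
      using less[OF e] t by simp_all
    then show ?thesis
      unfolding t(3) \<gamma>_def inner_linepath by linarith
  qed
  have "planar_drawing (path_graph (p i)) pos \<gamma>" for i
  proof -
    have "inj_on (\<lambda>a. v i \<bullet> pos a) (set (p i))"
      by (rule inj_on_if_sorted_wrt) (rule pos)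
    then have "inj_on pos (set (p i))"
      by (auto simp: inj_on_def)
    moreover have "simple_path (\<gamma> e)" if "e \<in> set (vwalk_arcs (p i))" for e
      using less[OF that] by (auto simp: \<gamma>_def)
    moreover have "\<gamma> e ` {0<..<1} \<inter> pos ` set (p i) = {}" if e: "e \<in> set (vwalk_arcs (p i))" for e
    proof -
      have False if "u \<in> set (p i)" "pos u \<in> \<gamma> e ` {0<..<1}" for u
        using strip[OF e that(2)] sorted_wrt_arc_no_vertex_between[OF pos e that(1)] by linarith
      then show ?thesis by (intro equals0I) (elim IntE imageE, blast)
    qed
    moreover have "\<gamma> e ` {0<..<1} \<inter> \<gamma> e' ` {0<..<1} = {}"
      if e: "e \<in> set (vwalk_arcs (p i))" "e' \<in> set (vwalk_arcs (p i))" "e \<noteq> e'" for e e'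
    proof -
      have False if "x \<in> \<gamma> e ` {0<..<1}" "x \<in> \<gamma> e' ` {0<..<1}" for x
        using strip[OF e(1) that(1)] strip[OF e(2) that(2)]
          sorted_wrt_arcs_separated[OF pos e] by linarith
      then show ?thesis by blast
    qed
    ultimately show ?thesis
      by (simp add: planar_drawing_def drawing_def path_graph_def \<gamma>_def)
  qed
  moreover have "monotone_drawing (v i) (path_graph (p i)) \<gamma>" for i
    using less
    by (auto simp: monotone_drawing_def path_graph_def \<gamma>_def inner_linepath intro!: strict_mono_onI)
  ultimately have "monotone_simultaneous_embedding (\<lambda>i. path_graph (p i)) v pos (\<lambda>_. \<gamma>)"
    by (simp add: monotone_simultaneous_embedding_def)
  then show ?L
    by (auto simp: admits_monotone_simultaneous_embedding_def)
qed

section \<open>Radial order in polar coordinates\<close>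

definition polar :: "real \<Rightarrow> real \<Rightarrow> real ^ 2" where
  "polar r \<theta> = vector [r * cos \<theta>, r * sin \<theta>]"

lemma polar_slope: "vector [1, t] = polar (sqrt (1 + t\<^sup>2)) (arctan t)"
proof -
  have "sqrt (1 + t\<^sup>2) \<noteq> 0"
    using sum_power2_gt_zero_iff[of 1 t] by simp
  then show ?thesis
    by (simp add: polar_def cos_arctan sin_arctan)
qed

text \<open>The complex quotient has argument \<beta> - \<alpha>; a full turn is added when this is
  negative, since \<open>Arg2pi\<close> takes values in [0, 2 pi).\<close>

lemma ccw_angle_polar:
  assumes "0 < r" "0 < s" "0 \<le> \<alpha>" "\<alpha> < 2 * pi" "0 \<le> \<beta>" "\<beta> < 2 * pi"
  shows "ccw_angle (polar r \<alpha>) (polar s \<beta>) = (if \<alpha> \<le> \<beta> then \<beta> - \<alpha> else \<beta> - \<alpha> + 2 * pi)"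
proof -
  have polar_cis: "Complex (polar q \<theta> $ 1) (polar q \<theta> $ 2) = of_real q * cis \<theta>" for q \<theta>
    by (simp add: polar_def complex_eq_iff)
  have "complex_of_real (s / r) * exp (\<i> * complex_of_real (if \<alpha> \<le> \<beta> then \<beta> - \<alpha> else \<beta> - \<alpha> + 2 * pi))
      = (of_real s * cis \<beta>) / (of_real r * cis \<alpha>)"
    using assms(1) cis_divide[of \<beta> \<alpha>] cis_mult[of "\<beta> - \<alpha>" "2 * pi", symmetric]
    by (simp add: cis_conv_exp[symmetric] divide_simps)
  then show ?thesis
    unfolding ccw_angle_def polar_cis
    using assms by (intro Arg2pi_unique[of "s / r"]) auto
qed

text \<open>With all angles in [0, pi), every reversed ray comes after every original one, so the
  order of the \<theta> values fixes the order of all the signed rays in [0, 2 pi). Sweeping from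
  any ray only cuts this order at that ray, so the comparison of two swept angles depends on
  pairwise comparisons alone.\<close>

lemma same_radial_order_polar:
  fixes \<theta> \<theta>' :: "'k \<Rightarrow> real"
  assumes r: "\<And>i. 0 < r i" "\<And>i. 0 < r' i"
    and \<theta>: "\<And>i. 0 \<le> \<theta> i \<and> \<theta> i < pi" "\<And>i. 0 \<le> \<theta>' i \<and> \<theta>' i < pi"
    and order: "\<And>i j. \<theta> i \<le> \<theta> j \<longleftrightarrow> \<theta>' i \<le> \<theta>' j"
  shows "same_radial_order (\<lambda>i. polar (r i) (\<theta> i)) (\<lambda>i. polar (r' i) (\<theta>' i))"
proof -
  define \<phi> where "\<phi> \<tau> a = \<tau> (fst a) + (if snd a then 0 else pi)"
    for \<tau> :: "'k \<Rightarrow> real" and a :: "'k \<times> bool"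
  have signed: "signed_vector (\<lambda>i. polar (q i) (\<tau> i)) a = polar (q (fst a)) (\<phi> \<tau> a)" for q \<tau> a
    by (auto simp: signed_vector_def polar_def \<phi>_def vec_eq_iff forall_2 split: prod.split)
  have range: "0 \<le> \<phi> \<theta> a" "\<phi> \<theta> a < 2 * pi" "0 \<le> \<phi> \<theta>' a" "\<phi> \<theta>' a < 2 * pi" for a
    using \<theta>[of "fst a"] pi_gt_zero by (auto simp: \<phi>_def simp del: pi_gt_zero)
  have \<phi>_order: "\<phi> \<theta> a \<le> \<phi> \<theta> b \<longleftrightarrow> \<phi> \<theta>' a \<le> \<phi> \<theta>' b" for a b
    using \<theta>[of "fst a"] \<theta>[of "fst b"] order[of "fst a" "fst b"] pi_gt_zero
    unfolding \<phi>_def by (smt (verit))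
  show ?thesis
    unfolding same_radial_order_def signed
  proof (intro allI)
    fix a b c :: "'k \<times> bool"
    show "ccw_angle (polar (r (fst a)) (\<phi> \<theta> a)) (polar (r (fst b)) (\<phi> \<theta> b))
          \<le> ccw_angle (polar (r (fst a)) (\<phi> \<theta> a)) (polar (r (fst c)) (\<phi> \<theta> c)) \<longleftrightarrow>
        ccw_angle (polar (r' (fst a)) (\<phi> \<theta>' a)) (polar (r' (fst b)) (\<phi> \<theta>' b))
          \<le> ccw_angle (polar (r' (fst a)) (\<phi> \<theta>' a)) (polar (r' (fst c)) (\<phi> \<theta>' c))"
      using \<phi>_order[of a b] \<phi>_order[of a c] \<phi>_order[of b c]
        range[of a] range[of b] range[of c] r
      by (simp add: ccw_angle_polar)
  qed
qed

definition slope_vectors :: "real \<Rightarrow> 4 \<Rightarrow> real ^ 2" where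
  "slope_vectors t i =
     (if i = 1 then vector [1, 0] else if i = 2 then vector [0, 1]
      else if i = 3 then vector [1, 1] else vector [1, t])"

text \<open>For every slope above 1 the fourth vector stays strictly between the diagonal and the
  vertical axis.\<close>

lemma same_radial_order_slope_vectors:
  assumes "1 < t" "1 < t'"
  shows "same_radial_order (slope_vectors t) (slope_vectors t')"
proof -
  define r where "r t i = (if i \<in> {1, 2} then 1 else if i = 3 then sqrt 2 else sqrt (1 + t\<^sup>2))"
    for t :: real and i :: 4
  define \<theta> where "\<theta> t i = (if i = 1 then 0 else if i = 2 then pi / 2
      else if i = 3 then arctan 1 else arctan t)"
    for t :: real and i :: 4
  have eq: "slope_vectors t = (\<lambda>i. polar (r t i) (\<theta> t i))" for t
    using polar_slope[of 0] polar_slope[of 1] polar_slope[of t]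
    by (auto simp: fun_eq_iff slope_vectors_def r_def \<theta>_def polar_def)
  have arctan: "0 < arctan 1" "arctan 1 < arctan t" "arctan t < pi / 2" if "1 < t" for t
    using that arctan_less_iff[of 1 t] zero_less_arctan_iff[of 1] arctan_ubound[of t] by auto
  have range: "0 \<le> \<theta> t i \<and> \<theta> t i < pi" if "1 < t" for t i
    using arctan[OF that] pi_gt_zero unfolding \<theta>_def by (smt (verit) field_sum_of_halves)
  have order: "\<theta> t i \<le> \<theta> t j \<longleftrightarrow> \<theta> t' i \<le> \<theta> t' j" for i j
    using arctan[OF assms(1)] arctan[OF assms(2)] unfolding \<theta>_def by (smt (verit))
  have "0 < r t i" for t i
    using sum_power2_gt_zero_iff[of 1 t] by (simp add: r_def)
  then show ?thesis
    unfolding eq using range assms order by (intro same_radial_order_polar) auto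
qed

section \<open>The four paths and the threshold on the slope\<close>

text \<open>Vertices 0 to 3 carry the obstruction. Deleting vertex 4 would make the third and fourth
  lists equal; its position relative to 0 keeps the paths distinct.\<close>

definition witness_path :: "4 \<Rightarrow> nat list" where
  "witness_path i =
     (if i = 1 then [0, 4, 2, 1, 3] else if i = 2 then [3, 1, 4, 2, 0]
      else if i = 3 then [1, 0, 4, 3, 2] else [1, 4, 0, 3, 2])"

lemma witness_path_embedding:
  "admits_monotone_simultaneous_embedding (\<lambda>i. path_graph (witness_path i)) (slope_vectors (3 / 2))"
  unfolding admits_monotone_simultaneous_embedding_path_graph_iff
proof (intro exI)
  define pos :: "nat \<Rightarrow> real ^ 2" where
    \<comment> \<open>Along the third list x + y takes the values -1, 0, 1, 6, 7; along the fourth x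
      + 3/2 y takes -6, -1, 0, 1/2, 13/2. Passing from 0 to 3 in the fourth needs t < 17/11, which
      3/2 satisfies.\<close>
    "pos n = (if n = 0 then vector [0, 0] else if n = 1 then vector [9, - 10]
      else if n = 2 then vector [8, - 1] else if n = 3 then vector [17, - 11]
      else vector [5, - 4])" for n
  show "\<forall>i. sorted_wrt (\<lambda>a b. slope_vectors (3 / 2) i \<bullet> pos a < slope_vectors (3 / 2) i \<bullet> pos b)
      (witness_path i)"
    by (simp add: forall_4 witness_path_def slope_vectors_def pos_def inner_vec_def sum_2)
qed

text \<open>
  Write \<open>x\<close>, \<open>y\<close> for the coordinates. The third path gives \<open>x\<^sub>1 - x\<^sub>0 < y\<^sub>0 - y\<^sub>1\<close> and
  \<open>x\<^sub>3 - x\<^sub>2 < y\<^sub>2 - y\<^sub>3\<close>. By the first path the two left sides add up to more than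
  \<open>x\<^sub>3 - x\<^sub>0\<close>, and by the second the two right sides to less than \<open>2 (y\<^sub>0 - y\<^sub>3)\<close>. The fourth
  path gives \<open>t (y\<^sub>0 - y\<^sub>3) < x\<^sub>3 - x\<^sub>0\<close>, hence \<open>t < 2\<close>.
\<close>

lemma witness_path_no_embedding:
  assumes "2 \<le> t"
  shows "\<not> admits_monotone_simultaneous_embedding (\<lambda>i. path_graph (witness_path i)) (slope_vectors t)"
  unfolding admits_monotone_simultaneous_embedding_path_graph_iff
proof
  assume "\<exists>pos. \<forall>i. sorted_wrt (\<lambda>a b. slope_vectors t i \<bullet> pos a < slope_vectors t i \<bullet> pos b)
      (witness_path i)"
  then obtain pos where pos: "\<forall>i. sorted_wrt
      (\<lambda>a b. slope_vectors t i \<bullet> pos a < slope_vectors t i \<bullet> pos b) (witness_path i)"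
    by blast
  define x y where "x n = pos n $ 1" and "y n = pos n $ 2" for n
  have "x 2 < x 1" "y 3 < y 1" "y 2 < y 0" "y 3 < y 0"
    and "x 1 + y 1 < x 0 + y 0" "x 3 + y 3 < x 2 + y 2"
    and "x 0 + t * y 0 < x 3 + t * y 3"
    using pos
    by (simp_all add: forall_4 witness_path_def slope_vectors_def inner_vec_def sum_2 x_def y_def)
  moreover have "2 * (y 0 - y 3) \<le> t * (y 0 - y 3)"
    using assms \<open>y 3 < y 0\<close> by (intro mult_right_mono) simp_all
  ultimately show False
    by (simp add: algebra_simps)
qed

theorem proposition14:
  shows "\<exists>(V :: nat set) (P :: 4 \<Rightarrow> nat pair_pre_digraph) (v :: 4 \<Rightarrow> real ^ 2) (v' :: 4 \<Rightarrow> real ^ 2).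
    finite V \<and>
    inj P \<and> (\<forall>i. directed_spanning_path V (P i)) \<and>
    inj v \<and> (\<forall>i. v i \<noteq> 0) \<and>
    inj v' \<and> (\<forall>i. v' i \<noteq> 0) \<and>
    same_radial_order v v' \<and>
    admits_monotone_simultaneous_embedding P v \<and>
    \<not> admits_monotone_simultaneous_embedding P v'"
proof (intro exI conjI)
  let ?P = "\<lambda>i. path_graph (witness_path i)"
  show "finite {0, 1, 2, 3, 4 :: nat}"
    by simp
  show "inj ?P"
    unfolding inj_def path_graph_def
    by (simp add: forall_4 witness_path_def set_eq_subset)
  have "set (witness_path i) = {0, 1, 2, 3, 4}" "distinct (witness_path i)" "witness_path i \<noteq> []" for i
    by (auto simp: witness_path_def)
  then show "\<forall>i. directed_spanning_path {0, 1, 2, 3, 4} (?P i)"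
    using directed_spanning_path_path_graph by metis
  have inj: "inj (slope_vectors t)" and nonzero: "\<forall>i. slope_vectors t i \<noteq> 0" if "1 < t" for t
    using that
    by (simp_all add: inj_def forall_4 slope_vectors_def vec_eq_iff forall_2)
  show "inj (slope_vectors (3 / 2))" "\<forall>i. slope_vectors (3 / 2) i \<noteq> 0"
    "inj (slope_vectors 2)" "\<forall>i. slope_vectors 2 i \<noteq> 0"
    using inj nonzero by simp_all
  show "same_radial_order (slope_vectors (3 / 2)) (slope_vectors 2)"
    by (simp add: same_radial_order_slope_vectors)
  show "admits_monotone_simultaneous_embedding ?P (slope_vectors (3 / 2))"
    by (rule witness_path_embedding)
  show "\<not> admits_monotone_simultaneous_embedding ?P (slope_vectors 2)"
    by (simp add: witness_path_no_embedding)
qed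

end
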